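(* Let $U$ and $Z$ be real Banach spaces. Let $F: U \to \mathbb{R}$ be a functional which is locally Lipschitz at $u_0 \in U$, and let $G: U \to Z$ be a Fréchet differentiable transformation such that $G'(u_0)$ maps $U$ onto $Z$. Assume that $u_0$ is a local minimum of $F(u)$ subject to $G(u) = \theta$. Assume also that there exist $\alpha > 0$ and $K > 0$ such that if $\varphi \in U$ and $\|\varphi\|_U < \alpha$, then $$\|G'(u_0+\varphi) - G'(u_0)\| \leq K \|\varphi\|_U.$$ Then there exists $z_0^* \in Z^*$ such that $\theta \in \partial^0 F(u_0) + [G'(u_0)^*](z_0^* )$; that is, there exist $u^* \in \partial^0 F(u_0)$ and $z_0^* \in Z^*$ such that $$u^* + [G'(u_0)]^*(z_0^* ) = \theta,$$ so that $$\langle \varphi, u^* \rangle_U + \langle G'(u_0)\varphi, z_0^* \rangle_Z = 0, \quad \forall \varphi \in U.$$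
   Context: $\theta$ denotes the zero vector of the relevant space. For a Banach space $U$, $U^*$ is its topological dual and $\langle \varphi, u^*\rangle_U$ denotes the value of $u^* \in U^*$ at $\varphi \in U$; $G'(u_0)^*: Z^* \to U^*$ is the adjoint of the bounded linear operator $G'(u_0)$. A functional $F: U \to \mathbb{R}$ is locally Lipschitz at $u_0 \in U$ if there exist $r > 0$ and $K > 0$ such that $|F(u) - F(v)| \leq K\|u-v\|_U$ for all $u, v \in B_r(u_0) = \{v \in U : \|u_0 - v\|_U < r\}$. "$u_0$ is a local minimum of $F(u)$ subject to $G(u)=\theta$" means that $G(u_0)=\theta$ and there is $\delta>0$ such that $F(u) \ge F(u_0)$ for all $u \in U$ with $\|u-u_0\|_U<\delta$ and $G(u)=\theta$. For $F$ locally Lipschitz at $u \in U$ and $\varphi \in U$, define $$H_u(\varphi) = \sup\left\{ \limsup_{n\to\infty} \frac{F(u_n + t_n\varphi) - F(u_n)}{t_n} \;:\; \{u_n\} \subset U,\ \{t_n\} \subset \mathbb{R}^+,\ u_n \to u \text{ in } U,\ t_n \to 0^+ \right\},$$ where $\mathbb{R}^+$ denotes the positive reals. The generalized local sub-gradient set of $F$ at $u$ is $$\partial^0 F(u) = \{ u^* \in U^* : \langle \varphi, u^*\rangle_U \leq H_u(\varphi),\ \forall \varphi \in U\}.$$ *)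

theory Defs
  imports "HOL-Analysis.Analysis"
begin

type_synonym 'a dual = "'a \<Rightarrow>\<^sub>L real"

text \<open>The Banach space adjoint; the constant \<open>adjoint\<close> of the library is the inner product one.\<close>

lift_definition dual_adjoint ::
    "('a::real_normed_vector \<Rightarrow>\<^sub>L 'b::real_normed_vector) \<Rightarrow> 'b dual \<Rightarrow>\<^sub>L 'a dual"
  is "\<lambda>A z. z o\<^sub>L A"
  by (rule bounded_bilinear.bounded_linear_left[OF bounded_bilinear_blinfun_compose])

lemma dual_adjoint_apply: "dual_adjoint A z \<phi> = z (A \<phi>)"
  by (simp add: dual_adjoint.rep_eq)

definition locally_lipschitz_at :: "('a::metric_space \<Rightarrow> real) \<Rightarrow> 'a \<Rightarrow> bool" where
  "locally_lipschitz_at F u \<longleftrightarrow> (\<exists>r>0. \<exists>K>0. K-lipschitz_on (ball u r) F)"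

definition local_min_subject_to ::
    "('a::real_normed_vector \<Rightarrow> real) \<Rightarrow> ('a \<Rightarrow> 'b::zero) \<Rightarrow> 'a \<Rightarrow> bool" where
  "local_min_subject_to F G u0 \<longleftrightarrow>
     G u0 = 0 \<and> (\<exists>\<delta>>0. \<forall>u. norm (u - u0) < \<delta> \<and> G u = 0 \<longrightarrow> F u \<ge> F u0)"

text \<open>
  The supremum and the upper limits are taken in the extended reals, where they always exist.
  If \<open>F\<close> is locally Lipschitz at \<open>u\<close>, all of them are finite, and so agree with those in the reals.
\<close>

definition gen_dir_deriv :: "('a::real_normed_vector \<Rightarrow> real) \<Rightarrow> 'a \<Rightarrow> 'a \<Rightarrow> ereal" where
  "gen_dir_deriv F u \<phi> =
     Sup {limsup (\<lambda>n. ereal ((F (x n + t n *\<^sub>R \<phi>) - F (x n)) / t n)) | (x :: nat \<Rightarrow> 'a) (t :: nat \<Rightarrow> real).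
            x \<longlonglongrightarrow> u \<and> (\<forall>n. t n > 0) \<and> t \<longlonglongrightarrow> 0}"

definition gen_subgradients :: "('a::real_normed_vector \<Rightarrow> real) \<Rightarrow> 'a \<Rightarrow> 'a dual set" where
  "gen_subgradients F u = {u' :: 'a dual. \<forall>\<phi>. ereal (u' \<phi>) \<le> gen_dir_deriv F u \<phi>}"

end

theory Submission
  imports Defs
begin

text \<open>
  Write \<open>T\<close> for \<open>G' u0\<close> and \<open>H\<close> for \<open>gen_dir_deriv F u0\<close>. Since \<open>T\<close> is onto, a Newton iteration
  moves any point \<open>a\<close> near \<open>u0\<close> onto the constraint set at the cost of a displacement of at most
  \<open>C * norm (G a)\<close>. As \<open>F\<close> is Lipschitz, \<open>u0\<close> is then an unconstrained local minimum of
  \<open>F + M * norm \<circ> G\<close>, and differentiating along rays gives \<open>- M * norm (T \<phi>) \<le> H \<phi>\<close> for every \<open>\<phi>\<close>.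
  Hence \<open>z \<mapsto> inf {H x + M * norm (z - T x)}\<close>, the infimum being over \<open>x\<close>, is a finite sublinear
  functional on the target space. A linear minorant \<open>w\<close> of it, which exists by Hahn-Banach, is
  bounded by \<open>M\<close> and satisfies \<open>w (T x) \<le> H x\<close>, so \<open>- w\<close> is the multiplier.
\<close>

section \<open>Sublinear functionals\<close>

definition sublinear :: "('a::real_vector \<Rightarrow> real) \<Rightarrow> bool" where
  "sublinear p \<longleftrightarrow> (\<forall>x y. p (x + y) \<le> p x + p y) \<and> (\<forall>a\<ge>0. \<forall>x. p (a *\<^sub>R x) = a * p x)"

lemma sublinear_add: "sublinear p \<Longrightarrow> p (x + y) \<le> p x + p y"
  by (simp add: sublinear_def)

lemma sublinear_scale: "sublinear p \<Longrightarrow> 0 \<le> a \<Longrightarrow> p (a *\<^sub>R x) = a * p x"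
  by (simp add: sublinear_def)

lemma sublinear_0: "sublinear p \<Longrightarrow> p 0 = 0"
  using sublinear_scale[of p 0 0] by simp

lemma sublinear_minus: "sublinear p \<Longrightarrow> - p (- x) \<le> p x"
  using sublinear_add[of p x "- x"] sublinear_0[of p] by simp

text \<open>Applying the one-sided bound to \<open>inverse a\<close> and the vector
  \<open>a *\<^sub>R x\<close> gives the reverse bound. At the origin the factors 2 and 1/2 force
  \<open>p 0 = 0\<close>, which covers the factor 0.\<close>

lemma sublinearI:
  assumes add: "\<And>x y. p (x + y) \<le> p x + p y"
    and scale: "\<And>a x. 0 < a \<Longrightarrow> p (a *\<^sub>R x) \<le> a * p x"
  shows "sublinear p"
proof -
  have "p 0 = 0"
    using scale[of 2 0] scale[of "1/2" 0] by simp
  moreover have "a * p x \<le> p (a *\<^sub>R x)" if "0 < a" for a x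
    using scale[of "inverse a" "a *\<^sub>R x"] that by (simp add: field_simps)
  ultimately have "p (a *\<^sub>R x) = a * p x" if "0 \<le> a" for a x
    using that scale[of a x] by (cases "a = 0") (auto intro: antisym)
  with add show ?thesis
    by (simp add: sublinear_def)
qed

text \<open>Serves three constructions: lowering a functional along one direction, bounding a chain
  in Zorn's lemma, and the infimal convolution on the target space. Boundedness below is what makes
  the real \<open>Inf\<close> a genuine infimum.\<close>

lemma sublinear_Inf:
  fixes S :: "'a::real_vector \<Rightarrow> real set"
  assumes ne: "\<And>x. S x \<noteq> {}"
    and bdd: "\<And>x. bdd_below (S x)"
    and add: "\<And>x y a b. a \<in> S x \<Longrightarrow> b \<in> S y \<Longrightarrow> \<exists>c\<in>S (x + y). c \<le> a + b"
    and scale: "\<And>x a r. a \<in> S x \<Longrightarrow> 0 < r \<Longrightarrow> r * a \<in> S (r *\<^sub>R x)"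
  shows "sublinear (\<lambda>x. Inf (S x))"
proof (rule sublinearI)
  show "Inf (S (x + y)) \<le> Inf (S x) + Inf (S y)" for x y
  proof -
    have "Inf (S (x + y)) - b \<le> Inf (S x)" if b: "b \<in> S y" for b
    proof (rule cInf_greatest[OF ne])
      fix a assume "a \<in> S x"
      then obtain c where "c \<in> S (x + y)" "c \<le> a + b"
        using add b by blast
      then show "Inf (S (x + y)) - b \<le> a"
        using cInf_lower[OF _ bdd] by fastforce
    qed
    then have "Inf (S (x + y)) - Inf (S x) \<le> Inf (S y)"
      by (intro cInf_greatest[OF ne]) fastforce
    then show ?thesis
      by simp
  qed
  show "Inf (S (r *\<^sub>R x)) \<le> r * Inf (S x)" if "0 < r" for r x
  proof -
    have "Inf (S (r *\<^sub>R x)) / r \<le> Inf (S x)"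
    proof (rule cInf_greatest[OF ne])
      fix a assume "a \<in> S x"
      then have "Inf (S (r *\<^sub>R x)) \<le> r * a"
        using cInf_lower[OF scale bdd] that by blast
      then show "Inf (S (r *\<^sub>R x)) / r \<le> a"
        using that by (simp add: field_simps)
    qed
    then show ?thesis
      using that by (simp add: field_simps)
  qed
qed

text \<open>Minimality forces \<open>q\<close> to be odd. Subadditivity at \<open>- x\<close> and
  \<open>- y\<close> then reverses the inequality at \<open>x\<close> and \<open>y\<close>, and
  oddness extends homogeneity to negative factors.\<close>

lemma minimal_sublinear_linear:
  assumes q: "sublinear q"
    and minimal: "\<And>p. sublinear p \<Longrightarrow> (\<And>x. p x \<le> q x) \<Longrightarrow> p = q"
  shows "linear q"
proof -
  note [simp] = sublinear_0[OF q]
  have neg: "q (- y) = - q y" for y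
  proof -
    \<comment> \<open>The infimum below is a sublinear minorant of \<open>q\<close>, hence \<open>q\<close> itself, and \<open>t = 1\<close> bounds it at \<open>- y\<close> by \<open>- q y\<close>.\<close>
    let ?S = "\<lambda>x. (\<lambda>t. q (x + t *\<^sub>R y) - t * q y) ` {0..}"
    have bdd: "bdd_below (?S x)" for x
    proof (rule bdd_belowI2)
      fix t :: real assume "t \<in> {0..}"
      then have "t * q y = q (t *\<^sub>R y)"
        by (simp add: sublinear_scale[OF q])
      also have "\<dots> \<le> q (x + t *\<^sub>R y) + q (- x)"
        using sublinear_add[OF q, of "x + t *\<^sub>R y" "- x"] by simp
      finally show "- q (- x) \<le> q (x + t *\<^sub>R y) - t * q y"
        by simp
    qed
    have "sublinear (\<lambda>x. Inf (?S x))"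
    proof (rule sublinear_Inf[OF _ bdd])
      fix x x' a b assume "a \<in> ?S x" "b \<in> ?S x'"
      then obtain s t where st: "0 \<le> s" "0 \<le> t" "a = q (x + s *\<^sub>R y) - s * q y"
          "b = q (x' + t *\<^sub>R y) - t * q y"
        by auto
      have "q (x + x' + (s + t) *\<^sub>R y) \<le> q (x + s *\<^sub>R y) + q (x' + t *\<^sub>R y)"
        using sublinear_add[OF q, of "x + s *\<^sub>R y" "x' + t *\<^sub>R y"] by (simp add: algebra_simps)
      then show "\<exists>c\<in>?S (x + x'). c \<le> a + b"
        using st by (intro bexI[OF _ imageI[of "s + t"]]) (auto simp: algebra_simps)
    next
      fix x a and r :: real assume "a \<in> ?S x" and r: "0 < r"
      then obtain t where t: "0 \<le> t" "a = q (x + t *\<^sub>R y) - t * q y"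
        by auto
      have "r * a = q (r *\<^sub>R x + (r * t) *\<^sub>R y) - (r * t) * q y"
        using sublinear_scale[OF q, of r "x + t *\<^sub>R y"] r t by (simp add: scaleR_add_right right_diff_distrib)
      then show "r * a \<in> ?S (r *\<^sub>R x)"
        using r t by (intro image_eqI[of _ _ "r * t"]) auto
    qed auto
    moreover have "Inf (?S x) \<le> q x" for x
      by (rule cInf_lower2[OF imageI[of 0]]) (auto intro: bdd)
    ultimately have "(\<lambda>x. Inf (?S x)) = q"
      by (rule minimal)
    then have "q (- y) = Inf (?S (- y))"
      by (rule fun_cong[symmetric])
    also have "\<dots> \<le> - q y"
      by (rule cInf_lower2[OF imageI[of 1] _ bdd]) auto
    finally show ?thesis
      using sublinear_minus[OF q, of y] by simp
  qed
  show ?thesis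
  proof (rule linearI)
    show "q (x + y) = q x + q y" for x y
      using sublinear_add[OF q, of x y] sublinear_add[OF q, of "- x" "- y"]
        neg[of "x + y"] neg[of x] neg[of y] by simp
    show "q (r *\<^sub>R x) = r *\<^sub>R q x" for r x
      using sublinear_scale[OF q, of r x] sublinear_scale[OF q, of "- r" x] neg[of "r *\<^sub>R x"]
      by (cases "0 \<le> r") auto
  qed
qed

theorem hahn_banach_sublinear:
  assumes p: "sublinear p"
  obtains f where "linear f" "\<And>x. f x \<le> p x"
proof -
  define A where "A = {q. sublinear q \<and> (\<forall>x. q x \<le> p x)}"
  \<comment> \<open>The order is reversed: \<open>?P f g\<close> puts \<open>g\<close> below
    \<open>f\<close>, so the maximal element from Zorn's lemma is a minimal sublinear functional,
    and chains are bounded by pointwise infima.\<close>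
  let ?P = "\<lambda>f g :: 'a \<Rightarrow> real. \<forall>x. g x \<le> f x"
  have "\<exists>m\<in>A. \<forall>a\<in>A. ?P m a \<longrightarrow> a = m"
  proof (rule predicate_Zorn)
    show "partial_order_on A (relation_of ?P A)"
      by (rule partial_order_on_relation_ofI) (auto intro: order_trans antisym simp: fun_eq_iff)
    fix C assume "C \<in> Chains (relation_of ?P A)"
    then have chain: "(?P f g \<or> ?P g f) \<and> f \<in> A \<and> g \<in> A" if "f \<in> C" "g \<in> C" for f g
      using that unfolding Chains_def relation_of_def by auto
    show "\<exists>u\<in>A. \<forall>a\<in>C. ?P a u"
    proof (cases "C = {}")
      case True
      then show ?thesis
        using p by (auto simp: A_def)
    next
      case False
      let ?S = "\<lambda>x. (\<lambda>f. f x) ` C"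
      have C: "sublinear f" "f x \<le> p x" if "f \<in> C" for f x
        using chain[OF that that] by (auto simp: A_def)
      \<comment> \<open>Each \<open>f\<close> in the chain satisfies
        \<open>f x \<ge> - f (- x) \<ge> - p (- x)\<close>, a bound that does not depend on
        \<open>f\<close>.\<close>
      have bdd: "bdd_below (?S x)" for x
      proof (rule bdd_belowI2)
        show "- p (- x) \<le> f x" if "f \<in> C" for f
          using sublinear_minus[OF C(1)[OF that], of x] C(2)[OF that, of "- x"] by simp
      qed
      have "sublinear (\<lambda>x. Inf (?S x))"
      proof (rule sublinear_Inf[OF _ bdd])
        fix x y a b assume "a \<in> ?S x" "b \<in> ?S y"
        then obtain f g where fg: "f \<in> C" "g \<in> C" "a = f x" "b = g y"
          by auto
        \<comment> \<open>The values at \<open>x\<close> and \<open>y\<close> may come from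
          different members of the chain; the smaller of the two functionals serves at both
          points.\<close>
        from chain[OF fg(1,2)] consider "\<forall>x. f x \<le> g x" | "\<forall>x. g x \<le> f x"
          by auto
        then show "\<exists>c\<in>?S (x + y). c \<le> a + b"
        proof cases
          case 1
          then have "f (x + y) \<le> a + b"
            using sublinear_add[OF C(1)[OF fg(1)], of x y] fg(3,4) by (smt (verit))
          then show ?thesis
            using fg by blast
        next
          case 2
          then have "g (x + y) \<le> a + b"
            using sublinear_add[OF C(1)[OF fg(2)], of x y] fg(3,4) by (smt (verit))
          then show ?thesis
            using fg by blast
        qed
      next
        fix x a and r :: real assume "a \<in> ?S x" "0 < r"
        then show "r * a \<in> ?S (r *\<^sub>R x)"
          using C(1) by (auto simp: sublinear_scale intro!: image_eqI)
      qed (use False in auto)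
      moreover have le: "Inf (?S x) \<le> f x" if "f \<in> C" for f x
        using that by (intro cInf_lower bdd) auto
      moreover have "Inf (?S x) \<le> p x" for x
        using False le C(2) order_trans by blast
      ultimately show ?thesis
        by (intro bexI[of _ "\<lambda>x. Inf (?S x)"]) (auto simp: A_def)
    qed
  qed
  then obtain m where m: "sublinear m" "\<And>x. m x \<le> p x"
    and minimal: "\<And>q. sublinear q \<Longrightarrow> (\<And>x. q x \<le> p x) \<Longrightarrow> (\<And>x. q x \<le> m x) \<Longrightarrow> q = m"
    unfolding A_def by blast
  have "linear m"
  proof (rule minimal_sublinear_linear[OF m(1)])
    show "q = m" if "sublinear q" "\<And>x. q x \<le> m x" for q
      by (rule minimal[OF that(1) order_trans[OF that(2) m(2)] that(2)])
  qed
  with m that show thesis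
    by blast
qed

section \<open>Metric regularity\<close>

text \<open>The Baire category half of the open mapping theorem. The closed sets \<open>?C n\<close>
  cover the target because \<open>T\<close> is onto, so one of them contains a ball. Preimages with
  a small relative error suffice, since the iteration below absorbs the error.\<close>

lemma surj_approximate_preimage:
  fixes T :: "'a::real_normed_vector \<Rightarrow> 'b::banach"
  assumes T: "bounded_linear T" and surj: "surj T" and \<epsilon>: "0 < \<epsilon>"
  obtains c where "0 < c" "\<And>z. \<exists>x. norm x \<le> c * norm z \<and> norm (T x - z) \<le> \<epsilon> * norm z"
proof -
  interpret T: bounded_linear T by fact
  let ?C = "\<lambda>n::nat. closure (T ` cball 0 (real n))"
  have "\<Union>(range ?C) = UNIV"
  proof (intro equalityI UNIV_I subsetI)
    fix z :: 'b
    obtain x where x: "z = T x"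
      using surj by auto
    obtain n where "norm x \<le> real n"
      using real_arch_simple by blast
    then have "z \<in> ?C n"
      using x closure_subset by fastforce
    then show "z \<in> \<Union>(range ?C)"
      by blast
  qed
  moreover have "euclidean interior_of \<Union>(range ?C) = {}" if "\<forall>n. interior (?C n) = {}"
    using that by (intro Baire_category_alt) (auto simp: completely_metrizable_space_euclidean)
  ultimately have "\<not> (\<forall>n. interior (?C n) = {})"
    by (metis UNIV_not_empty euclidean_interior_of interior_UNIV)
  then obtain n z0 where "z0 \<in> interior (?C n)"
    by auto
  then obtain r where r: "0 < r" "ball z0 r \<subseteq> ?C n"
    by (meson interior_subset mem_interior order_trans)
  \<comment> \<open>Moves the ball from \<open>z0\<close> to the origin: \<open>z0 + z\<close> and
    \<open>z0 - z\<close> both lie in it, and half the difference of their approximate preimages is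
    an approximate preimage of \<open>z\<close>.\<close>
  have near: "\<exists>x. norm x \<le> real n \<and> norm (T x - z) < e" if "norm z < r" "0 < e" for z e
  proof -
    have "\<exists>x. norm x \<le> real n \<and> norm (T x - w) < e" if "w \<in> ball z0 r" for w
      using r(2) that \<open>0 < e\<close> by (force simp: closure_approachable dist_norm)
    from this[of "z0 + z"] this[of "z0 - z"] obtain x y where
      x: "norm x \<le> real n" "norm (T x - (z0 + z)) < e" and
      y: "norm y \<le> real n" "norm (T y - (z0 - z)) < e"
      using \<open>norm z < r\<close> by (auto simp: dist_norm)
    have "norm (x - y) \<le> 2 * real n"
      using norm_triangle_ineq4[of x y] x y by simp
    moreover have "T ((1/2) *\<^sub>R (x - y)) - z
        = (1/2) *\<^sub>R ((T x - (z0 + z)) - (T y - (z0 - z)))"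
      by (simp add: T.scaleR T.diff algebra_simps flip: scaleR_2)
    then have "norm (T ((1/2) *\<^sub>R (x - y)) - z) < e"
      using norm_triangle_ineq4[of "T x - (z0 + z)" "T y - (z0 - z)"] x y by simp
    ultimately show ?thesis
      by (intro exI[of _ "(1/2) *\<^sub>R (x - y)"]) auto
  qed
  show thesis
  proof
    \<comment> \<open>The summand 1 keeps the constant positive when \<open>n\<close> is 0; the
      factor \<open>2 / r\<close> comes from rescaling \<open>z\<close> to norm
      \<open>r / 2\<close>, where \<open>near\<close> applies.\<close>
    show "0 < 2 * (real n + 1) / r"
      using r by (simp add: add_nonneg_pos)
    show "\<exists>x. norm x \<le> 2 * (real n + 1) / r * norm z \<and> norm (T x - z) \<le> \<epsilon> * norm z" for z
    proof (cases "z = 0")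
      case True
      then show ?thesis
        by (intro exI[of _ 0]) (simp add: T.zero)
    next
      case False
      define s where "s = 2 * norm z / r"
      have s: "0 < s" "norm z < s * r"
        using False r by (auto simp: s_def)
      have "norm (z /\<^sub>R s) < r" "0 < \<epsilon> * norm z / s"
        using s \<epsilon> False by (auto simp: field_simps)
      then obtain x where x: "norm x \<le> real n" "norm (T x - z /\<^sub>R s) < \<epsilon> * norm z / s"
        using near by blast
      have "T (s *\<^sub>R x) - z = s *\<^sub>R (T x - z /\<^sub>R s)"
        using s by (simp add: T.scaleR algebra_simps)
      then have "norm (T (s *\<^sub>R x) - z) = s * norm (T x - z /\<^sub>R s)"
        using s by simp
      also have "\<dots> \<le> s * (\<epsilon> * norm z / s)"
        using x(2) s by (intro mult_left_mono) auto
      finally have "norm (T (s *\<^sub>R x) - z) \<le> \<epsilon> * norm z"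
        using s by simp
      moreover have "norm (s *\<^sub>R x) \<le> 2 * (real n + 1) / r * norm z"
      proof -
        have "norm (s *\<^sub>R x) \<le> s * (real n + 1)"
          using x s by simp
        also have "\<dots> = 2 * (real n + 1) / r * norm z"
          by (simp add: s_def)
        finally show ?thesis .
      qed
      ultimately show ?thesis
        by blast
    qed
  qed
qed

text \<open>The residual at least halves at each step, so the n-th correction is at most
  \<open>c * norm (G a) / 2 ^ n\<close>. These bounds sum to
  \<open>2 * c * norm (G a) \<le> \<rho>\<close>: the iterates stay in the ball, converge by
  completeness, and have a root as limit by continuity.\<close>

lemma root_by_residual_halving:
  fixes G :: "'a::banach \<Rightarrow> 'b::real_normed_vector"
  assumes cont: "continuous_on (cball a \<rho>) G"
    and step: "\<And>x. x \<in> cball a \<rho> \<Longrightarrow>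
      \<exists>y. norm y \<le> c * norm (G x) \<and> norm (G (x + y)) \<le> norm (G x) / 2"
    and small: "2 * c * norm (G a) \<le> \<rho>" and c: "0 \<le> c"
  obtains x where "G x = 0" "norm (x - a) \<le> 2 * c * norm (G a)"
proof -
  let ?g = "norm (G a)"
  obtain s where s: "\<And>x. x \<in> cball a \<rho> \<Longrightarrow>
      norm (s x) \<le> c * norm (G x) \<and> norm (G (x + s x)) \<le> norm (G x) / 2"
    using step by metis
  define X where "X n = ((\<lambda>x. x + s x) ^^ n) a" for n
  have X0: "X 0 = a" and XS: "X (Suc n) = X n + s (X n)" for n
    by (simp_all add: X_def)
  \<comment> \<open>The bound on the displacement is the sum of the first \<open>n\<close> terms of
    the geometric series of step lengths.\<close>
  have X: "norm (G (X n)) \<le> ?g / 2 ^ n \<and> norm (X n - a) \<le> 2 * c * ?g * (1 - 1 / 2 ^ n)" for n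
  proof (induction n)
    case 0
    then show ?case
      by (simp add: X0)
  next
    case (Suc n)
    have "2 * c * ?g * (1 - 1 / 2 ^ n) \<le> 2 * c * ?g"
      using c by (intro mult_left_le) auto
    then have "X n \<in> cball a \<rho>"
      using Suc small by (simp add: dist_norm norm_minus_commute)
    note sn = s[OF this]
    have "norm (s (X n)) \<le> c * (?g / 2 ^ n)"
      using sn Suc c by (meson mult_left_mono order_trans)
    then have "norm (X (Suc n) - a) \<le> 2 * c * ?g * (1 - 1 / 2 ^ n) + c * (?g / 2 ^ n)"
      using norm_triangle_ineq[of "X n - a" "s (X n)"] Suc
      by (simp add: XS add_diff_eq diff_add_eq flip: add_diff_eq)
    moreover have "norm (G (X (Suc n))) \<le> ?g / 2 ^ Suc n"
      using sn Suc by (simp add: XS)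
    ultimately show ?case
      by (simp add: field_simps)
  qed
  have Xa: "norm (X n - a) \<le> 2 * c * ?g" for n
  proof -
    have "2 * c * ?g * (1 - 1 / 2 ^ n) \<le> 2 * c * ?g"
      using c by (intro mult_left_le) auto
    then show ?thesis
      using X[of n] by simp
  qed
  then have Xin: "X n \<in> cball a \<rho>" for n
    using small order_trans by (fastforce simp: dist_norm norm_minus_commute)
  have "summable (\<lambda>n. X (Suc n) - X n)"
  proof (rule summable_comparison_test')
    show "summable (\<lambda>n. c * ?g * (1 / 2) ^ n)"
      by (intro summable_mult summable_geometric) simp
    show "norm (X (Suc n) - X n) \<le> c * ?g * (1 / 2) ^ n" for n
    proof -
      have "norm (s (X n)) \<le> c * (?g / 2 ^ n)"
        using s[OF Xin] X c by (meson mult_left_mono order_trans)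
      then show ?thesis
        by (simp add: XS power_one_over)
    qed
  qed
  then have "convergent X"
    by (simp add: summable_iff_convergent sum_lessThan_telescope convergent_diff_const_right_iff)
  then obtain x where x: "X \<longlonglongrightarrow> x"
    by (auto simp: convergent_def)
  have "x \<in> cball a \<rho>"
    using Xin by (intro Lim_in_closed_set[OF closed_cball _ _ x]) auto
  then have "(\<lambda>n. G (X n)) \<longlonglongrightarrow> G x"
    using cont Xin x by (auto intro!: continuous_on_tendsto_compose[OF cont x])
  moreover have "(\<lambda>n. G (X n)) \<longlonglongrightarrow> 0"
  proof (rule Lim_null_comparison)
    show "\<forall>\<^sub>F n in sequentially. norm (G (X n)) \<le> ?g / 2 ^ n"
      using X by simp
    show "(\<lambda>n. ?g / 2 ^ n) \<longlonglongrightarrow> 0"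
      by (rule LIMSEQ_divide_realpow_zero) simp
  qed
  ultimately have "G x = 0"
    using LIMSEQ_unique by blast
  moreover have "norm (x - a) \<le> 2 * c * ?g"
    using Xa by (intro Lim_bounded[of "\<lambda>n. norm (X n - a)"] tendsto_intros x) auto
  ultimately show thesis
    using that by blast
qed

text \<open>A Newton iteration with the derivative frozen at \<open>u0\<close>. Solving the linear
  equation approximately leaves a quarter of the residual, and the linearization error is at most
  another quarter, so the residual halves.\<close>

theorem lyusternik_graves:
  fixes G :: "'a::banach \<Rightarrow> 'b::banach" and G' :: "'a \<Rightarrow> 'a \<Rightarrow>\<^sub>L 'b"
  assumes deriv: "\<And>u. (G has_derivative G' u) (at u)"
    and cont: "isCont G' u0"
    and surj: "surj (G' u0)"
    and G0: "G u0 = 0"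
  obtains \<epsilon> C where "0 < \<epsilon>" "0 < C"
    "\<And>a. norm (a - u0) < \<epsilon> \<Longrightarrow> \<exists>x. G x = 0 \<and> norm (x - a) \<le> C * norm (G a)"
proof -
  obtain c where c: "0 < c"
    and pre: "\<And>z. \<exists>x. norm x \<le> c * norm z \<and> norm (G' u0 x - z) \<le> 1/4 * norm z"
    using surj_approximate_preimage[OF blinfun.bounded_linear_right surj, of "1/4"] by auto
  have Gcont: "isCont G u" for u
    using deriv has_derivative_continuous by blast
  \<comment> \<open>By the mean value inequality the linearization error is at most
    \<open>norm y / (4 * c)\<close>, and \<open>norm y \<le> c * norm (G x)\<close> turns this into
    a quarter of the residual.\<close>
  obtain \<delta> where \<delta>: "0 < \<delta>" and G'\<delta>: "\<And>u. dist u u0 < \<delta> \<Longrightarrow> norm (G' u - G' u0) < 1 / (4 * c)"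
    using cont c unfolding continuous_at_eps_delta by (metis dist_norm zero_less_divide_1_iff zero_less_mult_iff zero_less_numeral)
  have nearG: "\<exists>d>0. \<forall>u. dist u u0 < d \<longrightarrow> norm (G u) < e" if "0 < e" for e
    using Gcont[of u0] that G0 unfolding continuous_at_eps_delta by (auto simp: dist_norm)
  obtain \<delta>1 where \<delta>1: "0 < \<delta>1" "\<And>u. dist u u0 < \<delta>1 \<Longrightarrow> norm (G u) < \<delta> / (2 * c)"
    using nearG[of "\<delta> / (2 * c)"] \<delta> c by auto
  \<comment> \<open>A point within \<open>2 * \<rho>\<close> of \<open>u0\<close> is within
    \<open>\<delta> / 2\<close>, and \<delta>1 makes its correction shorter than
    \<open>\<delta> / 2\<close>, so the segment between them stays in the ball of radius \<delta>.
    The radius \<delta>2 chosen next ensures \<open>2 * c * norm (G a) \<le> \<rho>\<close> at the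
    starting point.\<close>
  define \<rho> where "\<rho> = min \<delta> \<delta>1 / 4"
  have \<rho>: "0 < \<rho>" "4 * \<rho> \<le> \<delta>" "4 * \<rho> \<le> \<delta>1"
    using \<delta> \<delta>1 by (auto simp: \<rho>_def)
  obtain \<delta>2 where \<delta>2: "0 < \<delta>2" "\<And>u. dist u u0 < \<delta>2 \<Longrightarrow> norm (G u) < \<rho> / (2 * c)"
    using nearG[of "\<rho> / (2 * c)"] \<rho> c by auto
  have step: "\<exists>y. norm y \<le> c * norm (G x) \<and> norm (G (x + y)) \<le> norm (G x) / 2"
    if x: "dist x u0 \<le> 2 * \<rho>" for x
  proof -
    obtain y where y: "norm y \<le> c * norm (G x)" "norm (G' u0 y + G x) \<le> 1/4 * norm (G x)"
      using pre[of "- G x"] by auto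
    have "norm (G x) < \<delta> / (2 * c)"
      using x \<rho> by (intro \<delta>1) auto
    then have y\<delta>: "norm y < \<delta> / 2"
      using y(1) c by (simp add: field_simps)
    have "norm (G (x + y) - G x - G' u0 ((x + y) - x)) \<le> norm ((x + y) - x) * (1 / (4 * c))"
    proof (rule differentiable_bound_linearization[where S = "ball u0 \<delta>"
          and f' = "\<lambda>u. blinfun_apply (G' u)" and ?x0.0 = u0])
      show "x + t *\<^sub>R (x + y - x) \<in> ball u0 \<delta>" if "t \<in> {0..1}" for t
      proof -
        have "norm (t *\<^sub>R y) \<le> norm y"
          using that by (simp add: mult_left_le_one_le)
        then show ?thesis
          using norm_triangle_ineq[of "x - u0" "t *\<^sub>R y"] x y\<delta> \<rho>
          by (simp add: dist_norm norm_minus_commute algebra_simps)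
      qed
      show "(G has_derivative G' v) (at v within ball u0 \<delta>)" for v
        using deriv has_derivative_at_withinI by blast
      show "onorm (blinfun_apply (G' v) - blinfun_apply (G' u0)) \<le> 1 / (4 * c)" if "v \<in> ball u0 \<delta>" for v
        using G'\<delta>[of v] that by (simp add: dist_commute norm_blinfun.rep_eq minus_blinfun.rep_eq fun_diff_def)
      show "u0 \<in> ball u0 \<delta>"
        using \<delta> by simp
    qed
    then have "norm (G (x + y) - (G' u0 y + G x)) \<le> norm y / (4 * c)"
      by (simp add: algebra_simps)
    also have "\<dots> \<le> norm (G x) / 4"
      using y(1) c by (simp add: field_simps)
    finally have "norm (G (x + y)) \<le> norm (G x) / 2"
      using norm_triangle_sub[of "G (x + y)" "G' u0 y + G x"] y(2) by simp
    with y(1) show ?thesis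
      by blast
  qed
  show thesis
  proof
    show "0 < min \<rho> \<delta>2" "0 < 2 * c"
      using \<rho> \<delta>2 c by auto
    fix a assume a: "norm (a - u0) < min \<rho> \<delta>2"
    have "norm (G a) < \<rho> / (2 * c)"
      using a by (intro \<delta>2) (simp add: dist_norm)
    then have "2 * c * norm (G a) \<le> \<rho>"
      using c by (simp add: field_simps)
    moreover have "dist x u0 \<le> 2 * \<rho>" if "x \<in> cball a \<rho>" for x
      using dist_triangle[of x u0 a] a that by (simp add: dist_norm norm_minus_commute)
    ultimately show "\<exists>x. G x = 0 \<and> norm (x - a) \<le> 2 * c * norm (G a)"
      using root_by_residual_halving[of a \<rho> G c] step c Gcont
      by (metis continuous_at_imp_continuous_on less_imp_le)
  qed
qed

section \<open>The generalized directional derivative\<close>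

lemma gen_dir_deriv_upper:
  assumes "x \<longlonglongrightarrow> u" "\<And>n. 0 < t n" "t \<longlonglongrightarrow> 0"
  shows "limsup (\<lambda>n. ereal ((F (x n + t n *\<^sub>R \<phi>) - F (x n)) / t n)) \<le> gen_dir_deriv F u \<phi>"
  unfolding gen_dir_deriv_def using assms by (intro Sup_upper) blast

lemma gen_dir_deriv_least:
  assumes "\<And>x t. x \<longlonglongrightarrow> u \<Longrightarrow> (\<And>n. 0 < t n) \<Longrightarrow> t \<longlonglongrightarrow> 0 \<Longrightarrow>
    limsup (\<lambda>n. ereal ((F (x n + t n *\<^sub>R \<phi>) - F (x n)) / t n)) \<le> b"
  shows "gen_dir_deriv F u \<phi> \<le> b"
  unfolding gen_dir_deriv_def using assms by (intro Sup_least) blast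

lemma tendsto_add_scaleR:
  fixes x :: "nat \<Rightarrow> 'a::real_normed_vector"
  assumes "x \<longlonglongrightarrow> u" "t \<longlonglongrightarrow> 0"
  shows "(\<lambda>n. x n + t n *\<^sub>R \<phi>) \<longlonglongrightarrow> u"
  using tendsto_add[OF assms(1) tendsto_scaleR[OF assms(2) tendsto_const[of \<phi>]]] by simp

text \<open>The quotient for \<phi> + \<psi> at \<open>x n\<close> splits into the quotient for
  \<phi> at \<open>x n\<close> and the quotient for \<psi> at
  \<open>x n + t n *\<^sub>R \<phi>\<close>. The shifted base points still tend to \<open>u\<close>,
  so both are admissible in the supremum.\<close>

lemma gen_dir_deriv_add:
  "gen_dir_deriv F u (\<phi> + \<psi>) \<le> gen_dir_deriv F u \<phi> + gen_dir_deriv F u \<psi>"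
proof (rule gen_dir_deriv_least)
  fix x :: "nat \<Rightarrow> 'a" and t :: "nat \<Rightarrow> real"
  assume x: "x \<longlonglongrightarrow> u" and t: "\<And>n. 0 < t n" "t \<longlonglongrightarrow> 0"
  let ?y = "\<lambda>n. x n + t n *\<^sub>R \<phi>"
  let ?A = "\<lambda>n. ereal ((F (x n + t n *\<^sub>R \<phi>) - F (x n)) / t n)"
  let ?B = "\<lambda>n. ereal ((F (?y n + t n *\<^sub>R \<psi>) - F (?y n)) / t n)"
  have "limsup (\<lambda>n. ereal ((F (x n + t n *\<^sub>R (\<phi> + \<psi>)) - F (x n)) / t n)) = limsup (\<lambda>n. ?A n + ?B n)"
    by (simp add: scaleR_add_right add.assoc flip: add_divide_distrib)
  also have "\<dots> \<le> limsup ?A + limsup ?B"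
    by (rule ereal_limsup_add_mono)
  also have "\<dots> \<le> gen_dir_deriv F u \<phi> + gen_dir_deriv F u \<psi>"
    by (intro add_mono gen_dir_deriv_upper tendsto_add_scaleR x t)
  finally show "limsup (\<lambda>n. ereal ((F (x n + t n *\<^sub>R (\<phi> + \<psi>)) - F (x n)) / t n))
      \<le> gen_dir_deriv F u \<phi> + gen_dir_deriv F u \<psi>" .
qed

text \<open>Replacing the step lengths \<open>t n\<close> by \<open>r * t n\<close> turns quotients
  for the scaled direction into \<open>r\<close> times quotients for \<phi>.\<close>

lemma gen_dir_deriv_scale:
  assumes r: "0 < r"
  shows "gen_dir_deriv F u (r *\<^sub>R \<phi>) \<le> ereal r * gen_dir_deriv F u \<phi>"
proof (rule gen_dir_deriv_least)
  fix x :: "nat \<Rightarrow> 'a" and t :: "nat \<Rightarrow> real"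
  assume x: "x \<longlonglongrightarrow> u" and t: "\<And>n. 0 < t n" "t \<longlonglongrightarrow> 0"
  let ?A = "\<lambda>n. ereal ((F (x n + (r * t n) *\<^sub>R \<phi>) - F (x n)) / (r * t n))"
  have "(F (x n + t n *\<^sub>R r *\<^sub>R \<phi>) - F (x n)) / t n
      = r * ((F (x n + (r * t n) *\<^sub>R \<phi>) - F (x n)) / (r * t n))" for n
    using r by (simp add: mult.commute)
  then have "limsup (\<lambda>n. ereal ((F (x n + t n *\<^sub>R r *\<^sub>R \<phi>) - F (x n)) / t n))
      = limsup (\<lambda>n. ereal r * ?A n)"
    by simp
  also have "\<dots> = ereal r * limsup ?A"
    using r by (intro limsup_ereal_mult_left) simp
  also have "\<dots> \<le> ereal r * gen_dir_deriv F u \<phi>"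
    using r t by (intro ereal_mult_left_mono gen_dir_deriv_upper x tendsto_mult_right_zero) auto
  finally show "limsup (\<lambda>n. ereal ((F (x n + t n *\<^sub>R r *\<^sub>R \<phi>) - F (x n)) / t n))
      \<le> ereal r * gen_dir_deriv F u \<phi>" .
qed

text \<open>Base points and shifted points eventually lie in the ball. This is the upper half of the
  finiteness of the directional derivative; the penalty bound supplies the lower half.\<close>

lemma gen_dir_deriv_le_lipschitz:
  assumes lip: "L-lipschitz_on (ball u \<delta>) F" and \<delta>: "0 < \<delta>"
  shows "gen_dir_deriv F u \<phi> \<le> ereal (L * norm \<phi>)"
proof (rule gen_dir_deriv_least)
  fix x :: "nat \<Rightarrow> 'a" and t :: "nat \<Rightarrow> real"
  assume x: "x \<longlonglongrightarrow> u" and t: "\<And>n. 0 < t n" "t \<longlonglongrightarrow> 0"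
  have "\<forall>\<^sub>F n in sequentially. x n \<in> ball u \<delta>"
    using x \<delta> by (intro topological_tendstoD) auto
  moreover have "\<forall>\<^sub>F n in sequentially. x n + t n *\<^sub>R \<phi> \<in> ball u \<delta>"
    using tendsto_add_scaleR[OF x t(2)] \<delta> by (intro topological_tendstoD) auto
  ultimately have "\<forall>\<^sub>F n in sequentially.
      ereal ((F (x n + t n *\<^sub>R \<phi>) - F (x n)) / t n) \<le> ereal (L * norm \<phi>)"
  proof eventually_elim
    case (elim n)
    then have "F (x n + t n *\<^sub>R \<phi>) - F (x n) \<le> L * (t n * norm \<phi>)"
      using lipschitz_onD[OF lip elim(2,1)] t(1)[of n] by (simp add: dist_norm)
    then show ?case
      using t(1)[of n] by (simp add: field_simps)
  qed
  then show "limsup (\<lambda>n. ereal ((F (x n + t n *\<^sub>R \<phi>) - F (x n)) / t n)) \<le> ereal (L * norm \<phi>)"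
    by (rule Limsup_bounded)
qed

text \<open>The constant base point \<open>u\<close> with steps \<open>1 / (n + 1)\<close> is one
  admissible choice in the supremum. Its quotients are eventually at least
  \<open>- M * norm (G (?a n) /\<^sub>R t n)\<close>, which tends to the left-hand side because
  \<open>G u = 0\<close>.\<close>

lemma gen_dir_deriv_penalty_lower:
  fixes G :: "'a::real_normed_vector \<Rightarrow> 'b::real_normed_vector"
  assumes min: "\<forall>\<^sub>F a in nhds u. F u \<le> F a + M * norm (G a)"
    and G: "(G has_derivative T) (at u)" and G0: "G u = 0"
  shows "ereal (- M * norm (T \<phi>)) \<le> gen_dir_deriv F u \<phi>"
proof -
  interpret T: bounded_linear T
    using G by (rule has_derivative_bounded_linear)
  define t where "t n = inverse (real (Suc n))" for n
  have t: "0 < t n" "t \<longlonglongrightarrow> 0" for n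
    using LIMSEQ_inverse_real_of_nat by (auto simp: t_def[abs_def])
  let ?a = "\<lambda>n. u + t n *\<^sub>R \<phi>"
  have a: "?a \<longlonglongrightarrow> u"
    by (intro tendsto_add_scaleR t tendsto_const)
  have "(\<lambda>n. G (?a n) /\<^sub>R t n) \<longlonglongrightarrow> T \<phi>"
  proof -
    have "((\<lambda>s. u + s *\<^sub>R \<phi>) has_derivative (\<lambda>s. s *\<^sub>R \<phi>)) (at 0)"
      by (auto intro!: derivative_eq_intros)
    then have "((\<lambda>s. G (u + s *\<^sub>R \<phi>)) has_derivative (\<lambda>s. T (s *\<^sub>R \<phi>))) (at 0)"
      by (rule has_derivative_compose) (simp add: G)
    then have "((\<lambda>s. (G (u + s *\<^sub>R \<phi>) - T (s *\<^sub>R \<phi>)) /\<^sub>R norm s) \<longlongrightarrow> 0) (at 0)"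
      using G0 by (simp add: has_derivative_at_within)
    moreover have "filterlim t (at 0) sequentially"
      using t by (auto simp: filterlim_at less_imp_neq[symmetric])
    ultimately have "(\<lambda>n. (G (?a n) - T (t n *\<^sub>R \<phi>)) /\<^sub>R norm (t n)) \<longlonglongrightarrow> 0"
      by (rule filterlim_compose)
    moreover have "(G (?a n) - T (t n *\<^sub>R \<phi>)) /\<^sub>R norm (t n) = G (?a n) /\<^sub>R t n - T \<phi>" for n
      using t(1)[of n] by (simp add: T.scaleR scaleR_diff_right)
    ultimately show ?thesis
      by (simp add: LIM_zero_iff)
  qed
  then have lim: "(\<lambda>n. ereal (- M * norm (G (?a n) /\<^sub>R t n))) \<longlonglongrightarrow> ereal (- M * norm (T \<phi>))"
    by (intro tendsto_intros)
  have "\<forall>\<^sub>F n in sequentially. F u \<le> F (?a n) + M * norm (G (?a n))"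
    by (rule eventually_compose_filterlim[OF min a])
  then have "\<forall>\<^sub>F n in sequentially.
      ereal (- M * norm (G (?a n) /\<^sub>R t n)) \<le> ereal ((F (?a n) - F u) / t n)"
  proof eventually_elim
    case (elim n)
    then show ?case
      using t(1)[of n] by (simp add: field_simps)
  qed
  then have "limsup (\<lambda>n. ereal (- M * norm (G (?a n) /\<^sub>R t n)))
      \<le> limsup (\<lambda>n. ereal ((F (?a n) - F u) / t n))"
    by (rule Limsup_mono)
  also have "\<dots> \<le> gen_dir_deriv F u \<phi>"
    using gen_dir_deriv_upper[OF tendsto_const t] by blast
  finally show ?thesis
    using lim_imp_Limsup[OF _ lim] by simp
qed

section \<open>The multiplier rule\<close>

text \<open>A feasible \<open>x\<close> lies within \<open>C * norm (G a)\<close> of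
  \<open>a\<close>. Passing from \<open>a\<close> to \<open>x\<close> raises \<open>F\<close> by at
  most \<open>L\<close> times this distance, and \<open>F x\<close> is at least
  \<open>F u0\<close>.\<close>

lemma exact_penalty:
  assumes min: "local_min_subject_to F G u0"
    and lip: "L-lipschitz_on (ball u0 r) F" and r: "0 < r"
    and G: "isCont G u0"
    and regular: "0 < \<epsilon>" "0 < C"
      "\<And>a. norm (a - u0) < \<epsilon> \<Longrightarrow> \<exists>x. G x = 0 \<and> norm (x - a) \<le> C * norm (G a)"
  shows "\<forall>\<^sub>F a in nhds u0. F u0 \<le> F a + L * C * norm (G a)"
proof -
  obtain \<delta> where G0: "G u0 = 0" and \<delta>: "0 < \<delta>"
    "\<And>u. norm (u - u0) < \<delta> \<Longrightarrow> G u = 0 \<Longrightarrow> F u0 \<le> F u"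
    using min by (auto simp: local_min_subject_to_def)
  \<comment> \<open>Half of the smaller radius: with \<open>a\<close> within \<open>m\<close> of
    \<open>u0\<close> and \<open>x\<close> within \<open>m\<close> of \<open>a\<close>, both the
    Lipschitz bound and local minimality apply at \<open>x\<close>.\<close>
  define m where "m = min r \<delta> / 2"
  have m: "0 < m" "2 * m \<le> r" "2 * m \<le> \<delta>"
    using r \<delta> by (auto simp: m_def)
  have L: "0 \<le> L"
    using lip by (rule lipschitz_on_nonneg)
  have "(G \<longlongrightarrow> 0) (nhds u0)"
    using G G0 tendsto_at_iff_tendsto_nhds[of G u0] by (simp add: isCont_def)
  then have "((\<lambda>a. C * norm (G a)) \<longlongrightarrow> 0) (nhds u0)"
    by (auto intro!: tendsto_eq_intros)
  then have "\<forall>\<^sub>F a in nhds u0. C * norm (G a) < m"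
    using m by (intro order_tendstoD) auto
  moreover have "\<forall>\<^sub>F a in nhds u0. a \<in> ball u0 (min \<epsilon> m)"
    using regular m by (intro eventually_nhds_in_open) auto
  ultimately show ?thesis
  proof eventually_elim
    case (elim a)
    then have a: "norm (a - u0) < \<epsilon>" "norm (a - u0) < m"
      by (auto simp: dist_norm norm_minus_commute)
    then obtain x where x: "G x = 0" "norm (x - a) \<le> C * norm (G a)"
      using regular by blast
    have xu: "norm (x - u0) < 2 * m"
      using norm_triangle_ineq[of "x - a" "a - u0"] a x elim by simp
    then have "F u0 \<le> F x"
      using m x by (intro \<delta>) auto
    also have "F x \<le> F a + L * norm (x - a)"
    proof -
      have "x \<in> ball u0 r" "a \<in> ball u0 r"
        using xu a m by (auto simp: dist_norm norm_minus_commute)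
      then show ?thesis
        using lipschitz_onD[OF lip, of x a] by (auto simp: dist_norm)
    qed
    also have "L * norm (x - a) \<le> L * C * norm (G a)"
      using mult_left_mono[OF x(2) L] by (simp add: mult.assoc)
    finally show ?case
      by simp
  qed
qed

text \<open>The hypothesis \<open>lower\<close> and the triangle inequality bound the infimal
  convolution below by \<open>- M * norm z\<close>, so it is finite and Hahn-Banach applies on the
  target space.\<close>

lemma sublinear_image_minorant:
  fixes T :: "'a::real_normed_vector \<Rightarrow> 'b::real_normed_vector"
  assumes h: "sublinear h" and T: "linear T"
    and lower: "\<And>x. - M * norm (T x) \<le> h x" and M: "0 \<le> M"
  obtains w :: "'b dual" where "\<And>x. w (T x) \<le> h x"
proof -
  interpret T: linear T by fact
  let ?S = "\<lambda>z. range (\<lambda>x. h x + M * norm (z - T x))"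
  have bdd: "bdd_below (?S z)" for z
  proof (rule bdd_belowI2)
    fix x
    have "norm (T x) \<le> norm (z - T x) + norm z"
      using norm_triangle_sub[of "T x" z] by (simp add: norm_minus_commute)
    then have "M * norm (T x) \<le> M * norm (z - T x) + M * norm z"
      using mult_left_mono[OF _ M] by (fastforce simp flip: distrib_left)
    then show "- M * norm z \<le> h x + M * norm (z - T x)"
      using lower[of x] by simp
  qed
  have "sublinear (\<lambda>z. Inf (?S z))"
  proof (rule sublinear_Inf[OF _ bdd])
    fix z z' a b assume "a \<in> ?S z" "b \<in> ?S z'"
    then obtain x y where ab: "a = h x + M * norm (z - T x)" "b = h y + M * norm (z' - T y)"
      by auto
    have "norm (z + z' - T (x + y)) \<le> norm (z - T x) + norm (z' - T y)"
      using norm_triangle_ineq[of "z - T x" "z' - T y"] by (simp add: T.add algebra_simps)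
    then have "M * norm (z + z' - T (x + y)) \<le> M * norm (z - T x) + M * norm (z' - T y)"
      using mult_left_mono[OF _ M] by (fastforce simp flip: distrib_left)
    then have "h (x + y) + M * norm (z + z' - T (x + y)) \<le> a + b"
      using ab sublinear_add[OF h, of x y] by simp
    then show "\<exists>c\<in>?S (z + z'). c \<le> a + b"
      by blast
  next
    fix z a and r :: real assume "a \<in> ?S z" and r: "0 < r"
    then obtain x where a: "a = h x + M * norm (z - T x)"
      by auto
    have "norm (r *\<^sub>R z - T (r *\<^sub>R x)) = r * norm (z - T x)"
      using r by (simp add: T.scale flip: scaleR_diff_right)
    then have "r * a = h (r *\<^sub>R x) + M * norm (r *\<^sub>R z - T (r *\<^sub>R x))"
      using a r sublinear_scale[OF h, of r x] by (simp add: algebra_simps)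
    then show "r * a \<in> ?S (r *\<^sub>R z)"
      by blast
  qed auto
  then obtain f where f: "linear f" "\<And>z. f z \<le> Inf (?S z)"
    by (rule hahn_banach_sublinear) blast
  \<comment> \<open>Two choices are used: \<open>x = 0\<close> gives continuity of \<open>f\<close>
    with bound \<open>M\<close>, and \<open>z = T x\<close> gives the minorant property.\<close>
  have f_le: "f z \<le> h x + M * norm (z - T x)" for z x
    using f(2) by (rule order_trans) (intro cInf_lower rangeI bdd)
  have fM: "f z \<le> M * norm z" for z
    using f_le[of z 0] sublinear_0[OF h] by (simp add: T.zero)
  have "bounded_linear f"
  proof (rule bounded_linear_intro)
    show "norm (f z) \<le> norm z * M" for z
      using fM[of z] fM[of "- z"] linear_neg[OF f(1), of z] by (simp add: mult.commute)
  qed (simp_all add: linear_add[OF f(1)] linear_scale[OF f(1)])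
  then have "blinfun_apply (Blinfun f) = f"
    by (rule bounded_linear_Blinfun_apply)
  moreover have "f (T x) \<le> h x" for x
    using f_le[of "T x" x] by simp
  ultimately show thesis
    using that[of "Blinfun f"] by simp
qed

theorem theorem2p1:
  fixes F :: "'u::banach \<Rightarrow> real"
    and G :: "'u \<Rightarrow> 'z::banach"
    and G' :: "'u \<Rightarrow> 'u \<Rightarrow>\<^sub>L 'z"
    and u0 :: 'u
  assumes "locally_lipschitz_at F u0"
    and "\<And>u. (G has_derivative blinfun_apply (G' u)) (at u)"
    and "surj (blinfun_apply (G' u0))"
    and "local_min_subject_to F G u0"
    and "\<exists>\<alpha>>0. \<exists>K>0. \<forall>\<phi>. norm \<phi> < \<alpha> \<longrightarrow> norm (G' (u0 + \<phi>) - G' u0) \<le> K * norm \<phi>"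
  shows "\<exists>z0 :: 'z dual.
           0 \<in> (\<lambda>u'. u' + dual_adjoint (G' u0) z0) ` gen_subgradients F u0 \<and>
           (\<exists>u' \<in> gen_subgradients F u0.
              u' + dual_adjoint (G' u0) z0 = 0 \<and>
              (\<forall>\<phi>. u' \<phi> + z0 (G' u0 \<phi>) = 0))"
proof -
  let ?T = "blinfun_apply (G' u0)" and ?H = "gen_dir_deriv F u0"
  obtain r L where r: "0 < r" and L: "0 < L" and lip: "L-lipschitz_on (ball u0 r) F"
    using assms(1) by (auto simp: locally_lipschitz_at_def)
  have G0: "G u0 = 0"
    using assms(4) by (simp add: local_min_subject_to_def)
  \<comment> \<open>The Lipschitz estimate on the derivative supplies the continuity that the
    regularity theorem asks for.\<close>
  have "isCont G' u0"
  proof -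
    obtain \<alpha> K where \<alpha>: "0 < \<alpha>"
      and K: "\<And>\<phi>. norm \<phi> < \<alpha> \<Longrightarrow> norm (G' (u0 + \<phi>) - G' u0) \<le> K * norm \<phi>"
      using assms(5) by blast
    have "((\<lambda>\<phi>. G' (u0 + \<phi>) - G' u0) \<longlongrightarrow> 0) (at 0)"
    proof (rule Lim_null_comparison)
      show "\<forall>\<^sub>F \<phi> in at 0. norm (G' (u0 + \<phi>) - G' u0) \<le> K * norm \<phi>"
        using K \<alpha> by (auto simp: eventually_at intro!: exI[of _ \<alpha>])
      show "((\<lambda>\<phi>. K * norm \<phi>) \<longlongrightarrow> 0) (at (0::'u))"
        by (auto intro!: tendsto_eq_intros)
    qed
    then show ?thesis
      by (simp add: isCont_iff LIM_zero_iff)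
  qed
  then obtain \<epsilon> C where regular: "0 < \<epsilon>" "0 < C"
      "\<And>a. norm (a - u0) < \<epsilon> \<Longrightarrow> \<exists>x. G x = 0 \<and> norm (x - a) \<le> C * norm (G a)"
    using lyusternik_graves[OF assms(2) _ assms(3) G0] by metis
  have "\<forall>\<^sub>F a in nhds u0. F u0 \<le> F a + L * C * norm (G a)"
    using assms(2) has_derivative_continuous regular
    by (intro exact_penalty[OF assms(4) lip r]) blast+
  then have lower: "ereal (- (L * C) * norm (?T \<phi>)) \<le> ?H \<phi>" for \<phi>
    by (rule gen_dir_deriv_penalty_lower[OF _ assms(2) G0])
  \<comment> \<open>Both bounds on \<open>?H\<close> are finite, so passing to the reals loses
    nothing and the sublinear theory applies.\<close>
  define h where "h \<phi> = real_of_ereal (?H \<phi>)" for \<phi>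
  have h: "?H \<phi> = ereal (h \<phi>)" for \<phi>
    using lower[of \<phi>] gen_dir_deriv_le_lipschitz[OF lip r, of \<phi>]
    by (cases "?H \<phi>") (auto simp: h_def)
  have "sublinear h"
    using gen_dir_deriv_add[of F u0] gen_dir_deriv_scale[of _ F u0]
    by (intro sublinearI) (simp_all add: h)
  moreover have "- (L * C) * norm (?T \<phi>) \<le> h \<phi>" for \<phi>
    using lower[of \<phi>] by (simp add: h)
  moreover have "linear ?T"
    by (rule bounded_linear.linear[OF blinfun.bounded_linear_right])
  ultimately obtain w :: "'z dual" where w: "\<And>x. w (?T x) \<le> h x"
    using L regular(2) sublinear_image_minorant[of h ?T "L * C"] by (metis less_imp_le mult_nonneg_nonneg)
  \<comment> \<open>The pullback of \<open>w\<close> lies below \<open>?H\<close>, hence is a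
    subgradient; the multiplier that cancels it is \<open>- w\<close>.\<close>
  define u' where "u' = dual_adjoint (G' u0) w"
  have "u' \<in> gen_subgradients F u0"
    by (simp add: gen_subgradients_def h u'_def dual_adjoint_apply w)
  moreover have "u' + dual_adjoint (G' u0) (- w) = 0"
    by (simp add: u'_def blinfun.minus_right)
  moreover have "u' \<phi> + (- w) (?T \<phi>) = 0" for \<phi>
    by (simp add: u'_def dual_adjoint_apply blinfun.minus_left)
  ultimately show ?thesis
    by (intro exI[of _ "- w"] conjI) (auto simp: image_iff)
qed

end
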